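(* Let $(\mathbb{S},\oplus,\odot,\mathbf{0},\mathbf{1})$ be an idempotent commutative semiring, let $d\ge1$, let $z=(z_1,z_2,\dots)$ be an $\mathbb S^d$-valued time series that is eventually constant, and let $0\le s<t\le+\infty$. Then $\mathrm{ISS}^{\mathbb S,\mathrm{idem}}_{s,t}(z)$ is a shuffle character, i.e. for all words $v,w\in A^*$ $$\big\langle \mathrm{ISS}^{\mathbb S,\mathrm{idem}}_{s,t}(z),v\big\rangle\odot\big\langle \mathrm{ISS}^{\mathbb S,\mathrm{idem}}_{s,t}(z),w\big\rangle=\big\langle \mathrm{ISS}^{\mathbb S,\mathrm{idem}}_{s,t}(z),v\sqcup\!\sqcup\, w\big\rangle,$$ where $\sqcup\!\sqcup$ is the shuffle product.
   Context: A commutative semiring $(\mathbb S,\oplus,\odot,\mathbf 0,\mathbf 1)$ consists of two commutative monoids $(\mathbb S,\oplus,\mathbf 0)$ and $(\mathbb S,\odot,\mathbf 1)$ such that $\odot$ distributes over $\oplus$ and $\mathbf 0\odot s=\mathbf 0$ for all $s$. It is idempotent if $a\oplus a=a$ for all $a\in\mathbb S$. The alphabet $A$ is the set of all non-constant formal commutative monomials $[a_1\cdots a_m]$ ($m\ge1$, $a_i\in\{1,\dots,d\}$); $A^*$ is the set of words over $A$, with empty word $\mathbf e$; $\mathbb S\langle A\rangle$ is the free $\mathbb S$-semimodule on $A^*$. Maps $F:A^*\to\mathbb S$ are extended $\mathbb S$-linearly to $\mathbb S\langle A\rangle$, with value written $\langle F,w\rangle$. The shuffle product $\sqcup\!\sqcup$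 on $\mathbb S\langle A\rangle$ is the bilinear product with $u\sqcup\!\sqcup\,\mathbf e=\mathbf e\sqcup\!\sqcup\, u=u$ and $ua\sqcup\!\sqcup\, vb=(u\sqcup\!\sqcup\, vb)a+(ua\sqcup\!\sqcup\, v)b$ for $u,v\in A^*$, $a,b\in A$. For $z_j=(z_j^{(1)},\dots,z_j^{(d)})\in\mathbb S^d$ and $a=[a_1\cdots a_m]\in A$ put $z_j^{\odot a}:=z_j^{(a_1)}\odot\cdots\odot z_j^{(a_m)}$. For $z$ eventually constant, define for $w=w_1\cdots w_k$ with $w_i\in A$ $$\langle \mathrm{ISS}^{\mathbb S,\mathrm{idem}}_{s,t}(z),w\rangle:=\bigoplus_{s<j_1\le j_2\le\cdots\le j_k<t+1} z_{j_1}^{\odot w_1}\odot\cdots\odot z_{j_k}^{\odot w_k},$$ with value $\mathbf 1$ on the empty word. If $t=+\infty$, only finitely many distinct summands occur, and by idempotency the sum is defined as the sum over the finite set of distinct summands. *)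

theory Defs
  imports
    "HOL-Analysis.Finite_Cartesian_Product"
    "HOL-Library.Multiset"
    "HOL-Library.Poly_Mapping"
    "HOL-Library.Extended_Nat"
begin

text \<open>
  Commutative semirings are types of sort \<open>{comm_semiring_0, comm_monoid_mult}\<close>; the class
  \<open>comm_semiring_1\<close> would in addition demand \<open>0 \<noteq> 1\<close>. The index set \<open>{1, \<dots>, d}\<close> with
  \<open>d \<ge> 1\<close> is a finite type \<open>'d\<close>.
\<close>

section \<open>The alphabet of non-constant commutative monomials\<close>

text \<open>
  The monomial \<open>[a\<^sub>1 \<cdots> a\<^sub>m]\<close> is the multiset of the indices \<open>a\<^sub>1, \<dots>, a\<^sub>m\<close>, and \<open>m \<ge> 1\<close> excludes \<open>{#}\<close>.
\<close>

typedef 'd letter = "{m :: 'd multiset. m \<noteq> {#}}"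
  morphisms indices_of Letter
  by (rule exI[of _ "{#undefined#}"]) simp

definition monomial_eval :: "('a::comm_monoid_mult) ^ ('d::finite) \<Rightarrow> 'd letter \<Rightarrow> 'a" where
  "monomial_eval x a = (\<Prod>i\<in>#indices_of a. x $ i)"


section \<open>The free semimodule on words and the shuffle product\<close>

text \<open>
  The free \<open>'a\<close>-semimodule on the words over an alphabet \<open>'l\<close> is the type \<open>'l list \<Rightarrow>\<^sub>0 'a\<close> of
  finitely supported functions.
\<close>

definition of_word :: "'l list \<Rightarrow> ('l list \<Rightarrow>\<^sub>0 'a::{zero,one})" where
  "of_word w = Poly_Mapping.single w 1"

definition scale :: "'a \<Rightarrow> ('l list \<Rightarrow>\<^sub>0 'a) \<Rightarrow> ('l list \<Rightarrow>\<^sub>0 'a::comm_semiring_0)" where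
  "scale c p = Poly_Mapping.map (\<lambda>x. c * x) p"

text \<open>The linear extension of \<open>u \<mapsto> ua\<close>.\<close>

definition append_letter :: "('l list \<Rightarrow>\<^sub>0 'a) \<Rightarrow> 'l \<Rightarrow> ('l list \<Rightarrow>\<^sub>0 'a::comm_monoid_add)" where
  "append_letter p a =
     (\<Sum>u\<in>Poly_Mapping.keys p. Poly_Mapping.single (u @ [a]) (Poly_Mapping.lookup p u))"

text \<open>
  The shuffle product of two words, by recursion on their last letters. Multiplicities are kept:
  idempotency plays no role here.
\<close>

function shuffle_word ::
    "'l list \<Rightarrow> 'l list \<Rightarrow> ('l list \<Rightarrow>\<^sub>0 'a::{comm_semiring_0,comm_monoid_mult})" where
  "shuffle_word u [] = of_word u"
| "shuffle_word [] u = of_word u"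
| "shuffle_word (u @ [a]) (v @ [b]) =
     append_letter (shuffle_word u (v @ [b])) a + append_letter (shuffle_word (u @ [a]) v) b"
  by (auto, metis rev_exhaust)
termination
  by (relation "Wellfounded.measure (\<lambda>(u, v). length u + length v)") auto

text \<open>The bilinear extension.\<close>

definition shuffle ::
    "('l list \<Rightarrow>\<^sub>0 'a) \<Rightarrow> ('l list \<Rightarrow>\<^sub>0 'a) \<Rightarrow> ('l list \<Rightarrow>\<^sub>0 'a::{comm_semiring_0,comm_monoid_mult})"
    (infixl \<open>\<squnion>\<squnion>\<close> 70) where
  "p \<squnion>\<squnion> q =
     (\<Sum>u\<in>Poly_Mapping.keys p. \<Sum>v\<in>Poly_Mapping.keys q.
        scale (Poly_Mapping.lookup p u * Poly_Mapping.lookup q v) (shuffle_word u v))"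

text \<open>The linear extension of \<open>F\<close> from words to the free semimodule.\<close>

definition pairing :: "('l list \<Rightarrow> 'a) \<Rightarrow> ('l list \<Rightarrow>\<^sub>0 'a) \<Rightarrow> 'a::comm_semiring_0" where
  "pairing F p = (\<Sum>w\<in>Poly_Mapping.keys p. Poly_Mapping.lookup p w * F w)"

lemma scale_one [simp]: "scale 1 p = (p :: 'l list \<Rightarrow>\<^sub>0 'a::{comm_semiring_0,comm_monoid_mult})"
  by (rule poly_mapping_eqI) (simp add: scale_def map.rep_eq when_def)

lemma scale_zero [simp]: "scale 0 p = (0 :: 'l list \<Rightarrow>\<^sub>0 'a::comm_semiring_0)"
  by (rule poly_mapping_eqI) (simp add: scale_def map.rep_eq)

lemma trivial_semiring:
  "p = (0 :: 'l list \<Rightarrow>\<^sub>0 'a)" if "(1::'a::{comm_semiring_0,comm_monoid_mult}) = 0"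
proof (rule poly_mapping_eqI)
  fix k
  have "Poly_Mapping.lookup p k = 1 * Poly_Mapping.lookup p k" by simp
  also have "\<dots> = 0" by (simp only: that mult_zero_left)
  finally show "Poly_Mapping.lookup p k = Poly_Mapping.lookup 0 k" by simp
qed

lemma shuffle_of_word:
  "of_word u \<squnion>\<squnion> of_word v =
     (shuffle_word u v :: 'l list \<Rightarrow>\<^sub>0 'a::{comm_semiring_0,comm_monoid_mult})"
proof (cases "(1::'a) = 0")
  case True
  show ?thesis by (metis trivial_semiring True)
next
  case False
  then show ?thesis by (simp add: shuffle_def of_word_def)
qed

lemma pairing_of_word:
  "pairing F (of_word w) = (F w :: 'a::{comm_semiring_0,comm_monoid_mult})"
proof (cases "(1::'a) = 0")
  case True
  have "x = 0" for x :: 'a by (metis True mult_zero_left mult_1)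
  then show ?thesis by metis
next
  case False
  then show ?thesis by (simp add: pairing_def of_word_def)
qed


section \<open>Iterated sums\<close>

text \<open>A time series \<open>z\<^sub>1, z\<^sub>2, \<dots>\<close> is a function on \<open>nat\<close> whose value at \<open>0\<close> is never used.\<close>

definition eventually_constant :: "(nat \<Rightarrow> 'b) \<Rightarrow> bool" where
  "eventually_constant z \<longleftrightarrow> (\<exists>N. \<forall>j\<ge>N. z j = z N)"

text \<open>The index tuples \<open>s < j\<^sub>1 \<le> \<dots> \<le> j\<^sub>k < t + 1\<close>; here \<open>\<infinity> + 1 = \<infinity>\<close>.\<close>

definition index_tuples :: "nat \<Rightarrow> enat \<Rightarrow> nat \<Rightarrow> nat list set" where
  "index_tuples s t k =
     {js. length js = k \<and> sorted js \<and> (\<forall>j\<in>set js. s < j \<and> enat j < t + 1)}"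

definition iss_summand ::
    "(nat \<Rightarrow> ('a::comm_monoid_mult) ^ ('d::finite)) \<Rightarrow> 'd letter list \<Rightarrow> nat list \<Rightarrow> 'a" where
  "iss_summand z w js = (\<Prod>i<length w. monomial_eval (z (js ! i)) (w ! i))"

text \<open>
  For \<open>t = \<infinity>\<close> the sum ranges over the set of distinct summands, which is finite if \<open>z\<close> is
  eventually constant (see \<open>finite_iss_summands\<close> below).
\<close>

definition iss_idem ::
    "nat \<Rightarrow> enat \<Rightarrow> (nat \<Rightarrow> ('a::{comm_semiring_0,comm_monoid_mult}) ^ ('d::finite)) \<Rightarrow>
      'd letter list \<Rightarrow> 'a" where
  "iss_idem s t z w =
     (if t = \<infinity> then \<Sum>(iss_summand z w ` index_tuples s t (length w))
      else (\<Sum>js\<in>index_tuples s t (length w). iss_summand z w js))"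

lemma finite_index_tuples: "t \<noteq> \<infinity> \<Longrightarrow> finite (index_tuples s t k)"
proof -
  assume "t \<noteq> \<infinity>"
  then obtain n where "t = enat n" by auto
  then have "index_tuples s t k \<subseteq> {js. set js \<subseteq> {..n} \<and> length js = k}"
    by (auto simp: index_tuples_def one_enat_def)
  then show ?thesis
    by (rule finite_subset) (simp add: finite_lists_length_eq)
qed

lemma finite_iss_summands:
  assumes "eventually_constant z"
  shows "finite (iss_summand z w ` index_tuples s t (length w))"
proof -
  obtain N where N: "\<And>j. j \<ge> N \<Longrightarrow> z j = z N"
    using assms by (auto simp: eventually_constant_def)
  have "iss_summand z w js \<in> iss_summand z w ` {ks. set ks \<subseteq> {..N} \<and> length ks = length w}"
    if "length js = length w" for js
  proof
    have "z (min j N) = z j" for j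
      using N[of j] by (cases "j \<le> N") (auto simp: min_def)
    then show "iss_summand z w js = iss_summand z w (map (\<lambda>j. min j N) js)"
      using that by (simp add: iss_summand_def)
  qed (use that in auto)
  then have "iss_summand z w ` index_tuples s t (length w) \<subseteq>
      iss_summand z w ` {ks. set ks \<subseteq> {..N} \<and> length ks = length w}"
    by (auto simp: index_tuples_def)
  then show ?thesis
    by (rule finite_subset) (simp add: finite_lists_length_eq)
qed

lemma iss_idem_Nil: "iss_idem s t z [] = 1"
proof -
  have "index_tuples s t 0 = {[]}" for t
    by (auto simp: index_tuples_def)
  then show ?thesis by (simp add: iss_idem_def iss_summand_def)
qed

end

theory Submission
  imports Defs
begin

text \<open>
  Since \<open>z\<close> is eventually constant, the case \<open>t = \<infinity>\<close> has the same set of summands as a large finite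
  \<open>t\<close>. For finite \<open>t = n\<close>, splitting off the largest index gives
  \<open>F n (wa) = (\<Sum>j\<in>{s<..n}. F j w * z\<^sub>j\<^sup>a)\<close>. In the product of two such sums over indices \<open>i\<close> and \<open>j\<close>,
  the square is the union of the two closed triangles \<open>j \<le> i\<close> and \<open>i \<le> j\<close>; idempotency makes
  the overlapping diagonal harmless. Each triangle is one of the two terms of the shuffle recursion,
  and induction on the words concludes.
\<close>

text \<open>The right-hand side counts \<open>A \<inter> B\<close> twice, and idempotency absorbs
  the second copy.\<close>

lemma sum_Un_idempotent:
  fixes f :: "'b \<Rightarrow> 'a::comm_monoid_add"
  assumes idem: "\<And>a::'a. a + a = a" and "finite A" "finite B"
  shows "sum f (A \<union> B) = sum f A + sum f B"
proof -
  have "sum f A + sum f B = sum f (A - B) + (sum f (A \<inter> B) + sum f (A \<inter> B)) + sum f (B - A)"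
    using assms(2,3) sum.Int_Diff[of A f B] sum.Int_Diff[of B f A]
    by (simp add: ac_simps)
  also have "\<dots> = (sum f A) + sum f (B - A)"
    using assms(2) sum.Int_Diff[of A f B] by (simp add: idem ac_simps)
  also have "\<dots> = sum f (A \<union> (B - A))"
    using assms(2,3) by (intro sum.union_disjoint[symmetric]) auto
  finally show ?thesis by simp
qed

lemma sum_image_idempotent:
  fixes f :: "'b \<Rightarrow> 'a::comm_monoid_add"
  assumes idem: "\<And>a::'a. a + a = a" and "finite A"
  shows "\<Sum>(f ` A) = sum f A"
  using \<open>finite A\<close>
proof induction
  case (insert x A)
  have "\<Sum>(f ` insert x A) = \<Sum>({f x} \<union> f ` A)" by simp
  also have "\<dots> = f x + \<Sum>(f ` A)"
    using insert.hyps by (subst sum_Un_idempotent[OF idem]) auto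
  finally show ?case using insert by simp
qed simp

text \<open>Words outside the support have coefficient 0. This lets \<open>p\<close>,
  \<open>q\<close> and \<open>p + q\<close> be paired over one common index set, although their
  supports differ.\<close>

lemma pairing_superset:
  assumes "finite S" "Poly_Mapping.keys p \<subseteq> S"
  shows "pairing F p = (\<Sum>w\<in>S. Poly_Mapping.lookup p w * F w)"
  unfolding pairing_def
  by (rule sum.mono_neutral_left) (use assms in \<open>auto simp: in_keys_iff\<close>)

lemma pairing_zero [simp]: "pairing F 0 = 0"
  by (simp add: pairing_def)

lemma pairing_single: "pairing F (Poly_Mapping.single w c) = c * F w"
  by (subst pairing_superset[of "{w}"]) auto

lemma pairing_add: "pairing F (p + q) = pairing F p + pairing F q"
proof -
  let ?S = "Poly_Mapping.keys p \<union> Poly_Mapping.keys q"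
  have "Poly_Mapping.keys (p + q) \<subseteq> ?S" by (rule Poly_Mapping.keys_add)
  then show ?thesis
    by (simp add: pairing_superset[of ?S] lookup_add distrib_right sum.distrib)
qed

lemma pairing_sum: "pairing F (\<Sum>x\<in>A. p x) = (\<Sum>x\<in>A. pairing F (p x))"
  by (induction A rule: infinite_finite_induct) (simp_all add: pairing_add)

lemma pairing_append_letter: "pairing F (append_letter p a) = pairing (\<lambda>u. F (u @ [a])) p"
  by (simp add: append_letter_def pairing_sum pairing_single) (simp add: pairing_def)

lemma pairing_sum_left:
  "pairing (\<lambda>u. \<Sum>j\<in>A. F j u * g j) p = (\<Sum>j\<in>A. pairing (F j) p * g j)"
  unfolding pairing_def sum_distrib_left sum_distrib_right
  by (subst sum.swap) (simp add: mult.assoc)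

text \<open>Only the recursion on the last letter matters, so the iterated sums enter abstractly.
  The bound \<open>n\<close> varies in the induction because the recursion lowers it to the last
  index \<open>j\<close>.\<close>

lemma iterated_sum_shuffle:
  fixes F :: "nat \<Rightarrow> 'l list \<Rightarrow> 'a::{comm_semiring_0,comm_monoid_mult}"
  assumes idem: "\<And>a::'a. a + a = a"
    and Nil: "\<And>n. F n [] = 1"
    and snoc: "\<And>n w a. F n (w @ [a]) = (\<Sum>j\<in>{s<..n}. F j w * g j a)"
  shows "F n v * F n w = pairing (F n) (shuffle_word v w)"
proof (induction v w arbitrary: n rule: shuffle_word.induct)
  case (3 u a v b)
  \<comment> \<open>Here \<open>i\<close> is the last index used by \<open>u @ [a]\<close> and
    \<open>j\<close> the last one used by \<open>v @ [b]\<close>.\<close>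
  let ?f = "\<lambda>(i, j). (F i u * g i a) * (F j v * g j b)"
  let ?lower = "SIGMA i:{s<..n}. {s<..i}"
  let ?upper = "(\<lambda>(j, i). (i, j)) ` ?lower"
  have append: "pairing (F n) (append_letter p c) = (\<Sum>j\<in>{s<..n}. pairing (F j) p * g j c)" for p c
    by (simp add: pairing_append_letter snoc pairing_sum_left)
  have lower: "sum ?f ?lower = pairing (F n) (append_letter (shuffle_word u (v @ [b])) a)"
  proof -
    \<comment> \<open>For fixed \<open>i\<close>, summing over \<open>j \<le> i\<close> reassembles
      \<open>F i (v @ [b])\<close>, so \<open>a\<close> is the letter split off last.\<close>
    have "sum ?f ?lower = (\<Sum>i\<in>{s<..n}. (F i u * F i (v @ [b])) * g i a)"
      by (simp add: sum.Sigma[symmetric] snoc sum_distrib_left sum_distrib_right ac_simps)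
    then show ?thesis
      by (simp only: append "3.IH")
  qed
  have upper: "sum ?f ?upper = pairing (F n) (append_letter (shuffle_word (u @ [a]) v) b)"
  proof -
    have "sum ?f ?upper = (\<Sum>(j, i)\<in>?lower. (F i u * g i a) * (F j v * g j b))"
      by (subst sum.reindex) (auto simp: inj_on_def case_prod_unfold)
    also have "\<dots> = (\<Sum>j\<in>{s<..n}. (F j (u @ [a]) * F j v) * g j b)"
      by (simp add: sum.Sigma[symmetric] snoc sum_distrib_left sum_distrib_right ac_simps)
    finally show ?thesis
      by (simp only: append "3.IH")
  qed
  have square: "{s<..n} \<times> {s<..n} = ?lower \<union> ?upper"
    by (force simp: image_iff)
  have "F n (u @ [a]) * F n (v @ [b]) = sum ?f ({s<..n} \<times> {s<..n})"
    by (simp add: snoc sum_product sum.cartesian_product)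
  also have "\<dots> = sum ?f ?lower + sum ?f ?upper"
    unfolding square by (rule sum_Un_idempotent[OF idem]) auto
  finally show ?case
    by (simp add: lower upper pairing_add)
qed (simp_all add: Nil pairing_of_word)

lemma iss_summand_snoc:
  assumes "length js = length w"
  shows "iss_summand z (w @ [a]) (js @ [j]) = iss_summand z w js * monomial_eval (z j) a"
  using assms by (simp add: iss_summand_def nth_append)

text \<open>In a sorted tuple the last entry \<open>j\<close> is the largest, so sortedness amounts
  to bounding the remaining sorted entries by \<open>j\<close>.\<close>

lemma index_tuples_Suc:
  "index_tuples s (enat n) (Suc k) =
     (\<lambda>(j, js). js @ [j]) ` (SIGMA j:{s<..n}. index_tuples s (enat j) k)"
proof (intro equalityI subsetI)
  fix ks assume ks: "ks \<in> index_tuples s (enat n) (Suc k)"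
  then obtain js j where "ks = js @ [j]"
    by (cases ks rule: rev_cases) (auto simp: index_tuples_def)
  then show "ks \<in> (\<lambda>(j, js). js @ [j]) ` (SIGMA j:{s<..n}. index_tuples s (enat j) k)"
    using ks by (auto simp: index_tuples_def sorted_append one_enat_def less_Suc_eq_le image_iff)
next
  fix ks assume "ks \<in> (\<lambda>(j, js). js @ [j]) ` (SIGMA j:{s<..n}. index_tuples s (enat j) k)"
  then show "ks \<in> index_tuples s (enat n) (Suc k)"
    by (force simp: index_tuples_def sorted_append one_enat_def less_Suc_eq_le)
qed

lemma iss_idem_snoc:
  "iss_idem s (enat n) z (w @ [a]) =
     (\<Sum>j\<in>{s<..n}. iss_idem s (enat j) z w * monomial_eval (z j) a)"
proof -
  let ?I = "\<lambda>j. index_tuples s (enat j) (length w)"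
  have "iss_idem s (enat n) z (w @ [a]) =
      (\<Sum>(j, js)\<in>Sigma {s<..n} ?I. iss_summand z (w @ [a]) (js @ [j]))"
    unfolding iss_idem_def
    by (simp add: index_tuples_Suc, subst sum.reindex) (auto simp: inj_on_def case_prod_unfold)
  also have "\<dots> = (\<Sum>j\<in>{s<..n}. \<Sum>js\<in>?I j. iss_summand z (w @ [a]) (js @ [j]))"
    by (simp add: sum.Sigma finite_index_tuples)
  also have "\<dots> = (\<Sum>j\<in>{s<..n}. \<Sum>js\<in>?I j. iss_summand z w js * monomial_eval (z j) a)"
    by (intro sum.cong refl iss_summand_snoc) (simp add: index_tuples_def)
  finally show ?thesis
    by (simp add: iss_idem_def sum_distrib_right)
qed

lemma iss_idem_infinity:
  fixes z :: "nat \<Rightarrow> ('a::{comm_semiring_0,comm_monoid_mult}) ^ ('d::finite)"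
  assumes idem: "\<And>a::'a. a + a = a"
    and const: "\<And>j. j \<ge> n \<Longrightarrow> z j = z n" and "s < n"
  shows "iss_idem s \<infinity> z w = iss_idem s (enat n) z w"
proof -
  let ?f = "iss_summand z w" and ?I = "\<lambda>t. index_tuples s t (length w)"
  have "?f ` ?I \<infinity> = ?f ` ?I (enat n)"
  proof (intro equalityI image_subsetI)
    fix js assume js: "js \<in> ?I \<infinity>"
    \<comment> \<open>Truncating at \<open>n\<close> is monotone and leaves the values of
      \<open>z\<close> unchanged; \<open>s < n\<close> keeps the truncated indices above
      \<open>s\<close>.\<close>
    let ?ks = "map (\<lambda>j. min j n) js"
    have "z (min j n) = z j" for j
      using const[of j] by (cases "j \<le> n") (auto simp: min_def)
    then have "?f js = ?f ?ks"
      using js by (simp add: iss_summand_def index_tuples_def)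
    moreover have "sorted ?ks"
      using js by (auto simp: index_tuples_def sorted_iff_nth_mono intro: min.coboundedI1)
    then have "?ks \<in> ?I (enat n)"
      using js \<open>s < n\<close> by (auto simp: index_tuples_def one_enat_def)
    ultimately show "?f js \<in> ?f ` ?I (enat n)" by blast
  qed (auto simp: index_tuples_def)
  then show ?thesis
    by (simp add: iss_idem_def sum_image_idempotent[OF idem] finite_index_tuples)
qed

theorem lemma4p3:
  fixes z :: "nat \<Rightarrow> ('a::{comm_semiring_0,comm_monoid_mult}) ^ ('d::finite)"
    and s :: nat and t :: enat
    and v w :: "'d letter list"
  assumes idempotent: "\<And>a::'a. a + a = a"
    and "eventually_constant z"
    and "enat s < t"
  shows "iss_idem s t z v * iss_idem s t z w = pairing (iss_idem s t z) (of_word v \<squnion>\<squnion> of_word w)"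
proof -
  obtain n where n: "iss_idem s t z = iss_idem s (enat n) z"
  proof (cases t)
    case infinity
    obtain N where N: "\<And>j. j \<ge> N \<Longrightarrow> z j = z N"
      using assms(2) by (auto simp: eventually_constant_def)
    \<comment> \<open>The maximum with \<open>Suc s\<close> makes the finite bound exceed
      \<open>s\<close>, as truncation requires.\<close>
    have const: "z j = z (max N (Suc s))" if "j \<ge> max N (Suc s)" for j
      using N[of j] N[of "max N (Suc s)"] that by simp
    have "iss_idem s t z = iss_idem s (enat (max N (Suc s))) z"
      unfolding infinity by (rule ext, rule iss_idem_infinity, rule idempotent, erule const, simp)
    then show ?thesis by (rule that)
  qed (use that in blast)
  show ?thesis
    unfolding n shuffle_of_word
    by (rule iterated_sum_shuffle[where F = "\<lambda>n. iss_idem s (enat n) z", OF idempotent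
          iss_idem_Nil iss_idem_snoc])
qed

end
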